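(* Let $k,\ell$ be positive integers. Then $\mu_k(A_\ell)\le \ell+1$. If $\ell>k4^k$, then \[ \mu_k(A_\ell)=\left\lfloor \frac{\ell+1-k}{k}\right\rfloor, \] and every SOS-clique $\mathcal{F}\subseteq SOS_k(A_\ell)$ with $|\mathcal{F}|=\mu_k(A_\ell)$ is a sunflower.
   Context: Let $\varepsilon_1,\ldots,\varepsilon_{\ell+1}$ be the standard basis of $\mathbb{R}^{\ell+1}$. The root system $A_\ell$ is the set of vectors $\varepsilon_i-\varepsilon_j$, $i\neq j$. Two roots are strongly orthogonal if neither their sum nor their difference is a root (equivalently, in $A_\ell$, their supports are disjoint). $SOS_k(A_\ell)$ is the set of $k$-element subsets $\Gamma$ of $A_\ell$ whose elements are pairwise strongly orthogonal. For $\Gamma\in SOS_k(A_\ell)$ write $|\Gamma|=\sum_{\gamma\in\Gamma}\gamma\in\mathbb{R}^{\ell+1}$. A subset $\mathcal{F}\subseteq SOS_k(A_\ell)$ is an SOS-clique if for all distinct $\Gamma_i,\Gamma_j\in\mathcal{F}$ there exists $\Gamma_{i,j}\in SOS_k(A_\ell)$ with $|\Gamma_i|-|\Gamma_j|=|\Gamma_{i,j}|$. $\mu_k(A_\ell)$ denotes the maximum size of an SOS-clique in $SOS_k(A_\ell)$ (taken to be $0$ if $SOS_k(A_\ell)$ is empty). For $\Gamma,\Gamma'$ write $S(\Gamma,\Gamma')$ for the set of coordinates in which both $|\Gamma|$ and $|\Gamma'|$ are nonzero. An SOS-clique $\mathcal{F}$ is a sunflower if the sets $S(\Gamma_i,\Gamma_j)$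 are the same for all pairs of distinct $\Gamma_i,\Gamma_j\in\mathcal{F}$. *)

theory Defs
  imports "HOL-Analysis.Analysis"
begin

text \<open>
  The ambient space of the root system of type \<open>A\<^sub>\<ell>\<close> is \<open>real ^ 'n\<close> with \<open>CARD('n) = \<ell> + 1\<close>.
\<close>

definition roots_A :: "(real ^ 'n) set" where
  "roots_A = {axis i 1 - axis j 1 | i j. i \<noteq> j}"

text \<open>
  The sum and the difference are required to be neither roots nor zero. Excluding zero rules out
  the pair \<open>\<gamma>, -\<gamma>\<close>, for which neither \<open>0\<close> nor \<open>2\<gamma>\<close> is a root although the two
  roots are not even orthogonal. In type \<open>A\<^sub>\<ell>\<close> the notion is then the same as disjointness of supports,
  see \<open>strongly_orthogonal_roots_A_iff\<close> below.
\<close>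

definition strongly_orthogonal :: "(real ^ 'n) set \<Rightarrow> real ^ 'n \<Rightarrow> real ^ 'n \<Rightarrow> bool" where
  "strongly_orthogonal \<Phi> \<alpha> \<beta> \<longleftrightarrow> \<alpha> + \<beta> \<notin> insert 0 \<Phi> \<and> \<alpha> - \<beta> \<notin> insert 0 \<Phi>"

definition SOS :: "nat \<Rightarrow> (real ^ 'n) set \<Rightarrow> (real ^ 'n) set set" where
  "SOS k \<Phi> = {\<Gamma>. \<Gamma> \<subseteq> \<Phi> \<and> finite \<Gamma> \<and> card \<Gamma> = k \<and> pairwise (strongly_orthogonal \<Phi>) \<Gamma>}"

definition SOS_clique :: "nat \<Rightarrow> (real ^ 'n) set \<Rightarrow> (real ^ 'n) set set \<Rightarrow> bool" where
  "SOS_clique k \<Phi> \<F> \<longleftrightarrow> \<F> \<subseteq> SOS k \<Phi> \<and>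
     (\<forall>\<Gamma>\<in>\<F>. \<forall>\<Delta>\<in>\<F>. \<Gamma> \<noteq> \<Delta> \<longrightarrow> (\<exists>\<Theta>\<in>SOS k \<Phi>. \<Sum>\<Gamma> - \<Sum>\<Delta> = \<Sum>\<Theta>))"

text \<open>
  For finite \<open>\<Phi>\<close> this is a maximum over a finite set, which contains \<open>0\<close> because the empty
  family is a clique; so the value is \<open>0\<close> if \<open>SOS k \<Phi>\<close> is empty.
\<close>

definition max_SOS_clique :: "nat \<Rightarrow> (real ^ 'n) set \<Rightarrow> nat" where
  "max_SOS_clique k \<Phi> = Max {card \<F> | \<F>. SOS_clique k \<Phi> \<F>}"

definition common_support :: "(real ^ 'n) set \<Rightarrow> (real ^ 'n) set \<Rightarrow> 'n set" where
  "common_support \<Gamma> \<Delta> = {i. (\<Sum>\<Gamma>) $ i \<noteq> 0 \<and> (\<Sum>\<Delta>) $ i \<noteq> 0}"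

definition is_sunflower :: "(real ^ 'n) set set \<Rightarrow> bool" where
  "is_sunflower \<F> \<longleftrightarrow>
     (\<forall>\<Gamma>\<in>\<F>. \<forall>\<Delta>\<in>\<F>. \<forall>\<Gamma>'\<in>\<F>. \<forall>\<Delta>'\<in>\<F>.
        \<Gamma> \<noteq> \<Delta> \<longrightarrow> \<Gamma>' \<noteq> \<Delta>' \<longrightarrow> common_support \<Gamma> \<Delta> = common_support \<Gamma>' \<Delta>')"

lemma finite_roots_A: "finite (roots_A :: (real ^ 'n) set)"
proof -
  have "roots_A \<subseteq> (\<lambda>(i, j). axis i 1 - axis j 1 :: real ^ 'n) ` UNIV"
    by (auto simp: roots_A_def)
  then show ?thesis
    by (rule finite_subset) simp
qed

lemma finite_SOS_clique_cards:
  assumes "finite \<Phi>"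
  shows "finite {card \<F> | \<F>. SOS_clique k \<Phi> \<F>}" and "0 \<in> {card \<F> | \<F>. SOS_clique k \<Phi> \<F>}"
proof -
  have "{card \<F> | \<F>. SOS_clique k \<Phi> \<F>} \<subseteq> card ` Pow (Pow \<Phi>)"
    by (force simp: SOS_clique_def SOS_def)
  then show "finite {card \<F> | \<F>. SOS_clique k \<Phi> \<F>}"
    by (rule finite_subset) (simp add: assms)
  have "SOS_clique k \<Phi> {}"
    by (simp add: SOS_clique_def)
  then show "0 \<in> {card \<F> | \<F>. SOS_clique k \<Phi> \<F>}"
    by (metis (mono_tags, lifting) card.empty mem_Collect_eq)
qed

lemma strongly_orthogonal_roots_A_iff:
  assumes "\<alpha> \<in> roots_A" and "\<beta> \<in> roots_A"
  shows "strongly_orthogonal roots_A \<alpha> \<beta> \<longleftrightarrow> {i. \<alpha> $ i \<noteq> 0} \<inter> {i. \<beta> $ i \<noteq> 0} = {}"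
proof -
  obtain a b where \<alpha>: "\<alpha> = axis a 1 - axis b 1" and ab: "a \<noteq> b"
    using assms(1) by (auto simp: roots_A_def)
  obtain c d where \<beta>: "\<beta> = axis c 1 - axis d 1" and cd: "c \<noteq> d"
    using assms(2) by (auto simp: roots_A_def)
  have supp: "{i. \<alpha> $ i \<noteq> 0} = {a, b}" "{i. \<beta> $ i \<noteq> 0} = {c, d}"
    using ab cd by (auto simp: \<alpha> \<beta> axis_def split: if_splits)
  have root: "axis i 1 - axis j 1 \<in> insert 0 roots_A" for i j :: 'a
    by (cases "i = j") (auto simp: roots_A_def)
  show ?thesis
  proof (cases "{a, b} \<inter> {c, d} = {}")
    case True
    have no: "x \<notin> insert 0 roots_A"
      if x: "x $ a = 1" "x $ b = -1" "x $ c \<noteq> 0" for x :: "real ^ 'a"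
    proof
      assume "x \<in> insert 0 roots_A"
      then obtain i j where "x = axis i 1 - axis j 1"
        using x by (auto simp: roots_A_def)
      with x True ab show False
        by (auto simp: axis_def split: if_splits)
    qed
    have ne: "a \<noteq> c" "a \<noteq> d" "b \<noteq> c" "b \<noteq> d"
      using True by auto
    have "\<alpha> + \<beta> \<notin> insert 0 roots_A"
      by (rule no) (use ne ab cd in \<open>auto simp: \<alpha> \<beta> axis_def\<close>)
    moreover have "\<alpha> - \<beta> \<notin> insert 0 roots_A"
      by (rule no) (use ne ab cd in \<open>auto simp: \<alpha> \<beta> axis_def\<close>)
    ultimately show ?thesis
      using True by (simp add: strongly_orthogonal_def supp)
  next
    case False
    then consider "a = c" | "a = d" | "b = c" | "b = d"
      by auto
    then have "\<alpha> + \<beta> \<in> insert 0 roots_A \<or> \<alpha> - \<beta> \<in> insert 0 roots_A"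
    proof cases
      case 1
      have "\<alpha> - \<beta> = axis d 1 - axis b 1" by (simp add: \<alpha> \<beta> 1)
      with root show ?thesis by metis
    next
      case 2
      have "\<alpha> + \<beta> = axis c 1 - axis b 1" by (simp add: \<alpha> \<beta> 2)
      with root show ?thesis by metis
    next
      case 3
      have "\<alpha> + \<beta> = axis a 1 - axis d 1" by (simp add: \<alpha> \<beta> 3)
      with root show ?thesis by metis
    next
      case 4
      have "\<alpha> - \<beta> = axis a 1 - axis c 1" by (simp add: \<alpha> \<beta> 4)
      with root show ?thesis by metis
    qed
    with False show ?thesis
      by (auto simp: strongly_orthogonal_def supp)
  qed
qed

end

theory Submission
  imports Defs
begin

text \<open>
  The supports of the vectors \<open>\<Sum>\<Gamma>\<close> of a clique have \<open>2k\<close> elements and meet pairwise in exactly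
  \<open>k\<close>: the support of \<open>\<Sum>\<Gamma> - \<Sum>\<Delta>\<close> is their symmetric difference, because no coordinate of it is
  \<open>2\<close> or \<open>-2\<close>. The positive definite Gram matrix gives the bound \<open>\<ell> + 1\<close>. For \<open>m\<close> sets, with \<open>m\<close>
  large, van Lint's argument on equidistant codes shows that every coordinate lies in at most \<open>k\<close> or
  in at least \<open>m + 1 - k\<close> of them. Counting incidences, the coordinates of the second kind form a
  \<open>k\<close>-set contained in every support, so the supports are a sunflower with \<open>m\<close> petals of size \<open>k\<close>
  and \<open>k (m + 1) \<le> \<ell> + 1\<close>. Equality up to rounding is attained by the vectors \<open>1\<^sub>S - 1\<^sub>P\<close> for a
  fixed \<open>k\<close>-set \<open>S\<close> and disjoint \<open>k\<close>-sets \<open>P\<close> outside it.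
\<close>

section \<open>Supports, indicator vectors and their Gram matrix\<close>

definition support :: "real ^ 'n \<Rightarrow> 'n set" where
  "support v = {i. v $ i \<noteq> 0}"

definition indicator_vec :: "'n set \<Rightarrow> real ^ 'n" where
  "indicator_vec A = (\<chi> i. of_bool (i \<in> A))"

lemma inj_indicator_vec: "inj indicator_vec"
proof (rule injI)
  fix A B :: "'a set"
  assume "indicator_vec A = indicator_vec B"
  then have "of_bool (i \<in> A) = (of_bool (i \<in> B) :: real)" for i
    by (simp add: indicator_vec_def vec_eq_iff)
  then show "A = B"
    by (simp only: of_bool_eq_iff) blast
qed

lemma inner_indicator_vec:
  "indicator_vec A \<bullet> indicator_vec B = real (card (A \<inter> B))" for A B :: "'n::finite set"
proof -
  have "indicator_vec A \<bullet> indicator_vec B = (\<Sum>i\<in>UNIV. of_bool (i \<in> A \<inter> B))"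
    unfolding inner_vec_def indicator_vec_def by (intro sum.cong) auto
  then show ?thesis
    by (simp del: Int_iff)
qed

text \<open>What remains of a clique after passing to the supports of its sums. The size bound and
  the sunflower structure follow from this combinatorial data.\<close>

locale half_intersecting =
  fixes k :: nat and \<A> :: "'n::finite set set"
  assumes k_pos: "k > 0"
    and card_member: "A \<in> \<A> \<Longrightarrow> card A = 2 * k"
    and card_Int: "A \<in> \<A> \<Longrightarrow> B \<in> \<A> \<Longrightarrow> A \<noteq> B \<Longrightarrow> card (A \<inter> B) = k"
begin

text \<open>The Gram matrix has \<open>2 * k\<close> on the diagonal and \<open>k\<close> elsewhere,
  so it is \<open>k\<close> times the sum of the all-ones matrix and the identity. This is its
  quadratic form.\<close>

lemma inner_self_combination:
  fixes c :: "'n set \<Rightarrow> real"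
  defines "w \<equiv> \<Sum>A\<in>\<A>. c A *\<^sub>R indicator_vec A"
  shows "w \<bullet> w = real k * ((\<Sum>A\<in>\<A>. c A)\<^sup>2 + (\<Sum>A\<in>\<A>. (c A)\<^sup>2))"
proof -
  have "w \<bullet> w = (\<Sum>A\<in>\<A>. \<Sum>B\<in>\<A>. c A * c B * real (card (A \<inter> B)))"
    by (simp add: w_def inner_sum_left inner_sum_right inner_indicator_vec sum_distrib_left mult_ac Int_commute)
  also have "\<dots> = (\<Sum>A\<in>\<A>. \<Sum>B\<in>\<A>. real k * (c A * c B) + (if B = A then real k * (c A)\<^sup>2 else 0))"
    by (intro sum.cong refl) (auto simp: card_member card_Int power2_eq_square)
  also have "\<dots> = (\<Sum>A\<in>\<A>. \<Sum>B\<in>\<A>. real k * (c A * c B)) + (\<Sum>A\<in>\<A>. real k * (c A)\<^sup>2)"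
    by (simp add: sum.distrib)
  also have "(\<Sum>A\<in>\<A>. \<Sum>B\<in>\<A>. real k * (c A * c B)) = real k * (\<Sum>A\<in>\<A>. c A)\<^sup>2"
    unfolding power2_eq_square sum_product by (simp add: sum_distrib_left)
  finally show ?thesis
    by (simp add: sum_distrib_left distrib_left)
qed

text \<open>A vanishing combination has norm zero, which forces the sum of the squared coefficients
  to vanish. Hence the indicator vectors are independent.\<close>

lemma card_le_CARD: "card \<A> \<le> CARD('n)"
proof -
  have inj: "inj_on indicator_vec \<A>"
    using inj_indicator_vec by (rule inj_on_subset) simp
  have "independent (indicator_vec ` \<A>)"
  proof (rule independent_if_scalars_zero)
    fix f :: "real ^ 'n \<Rightarrow> real" and x
    assume sum0: "(\<Sum>x\<in>indicator_vec ` \<A>. f x *\<^sub>R x) = 0" and x: "x \<in> indicator_vec ` \<A>"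
    define c where "c A = f (indicator_vec A)" for A
    have "(\<Sum>A\<in>\<A>. c A *\<^sub>R indicator_vec A) = 0"
      using sum0 by (simp add: sum.reindex[OF inj] c_def)
    then have "(\<Sum>A\<in>\<A>. c A)\<^sup>2 + (\<Sum>A\<in>\<A>. (c A)\<^sup>2) = 0"
      using inner_self_combination[of c] k_pos by simp
    then have "(\<Sum>A\<in>\<A>. (c A)\<^sup>2) = 0"
      by (smt (verit) sum_nonneg zero_le_power2)
    then show "f x = 0"
      using x by (auto simp: c_def sum_nonneg_eq_0_iff)
  qed simp
  then show ?thesis
    using independent_bound[of "indicator_vec ` \<A>"] by (simp add: card_image[OF inj])
qed

section \<open>Degrees of coordinates\<close>

definition degree :: "'n \<Rightarrow> nat" where
  "degree x = card {A \<in> \<A>. x \<in> A}"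

lemma degree_le_card: "degree x \<le> card \<A>"
  unfolding degree_def by (rule card_mono) auto

lemma sum_degree: "(\<Sum>x\<in>X. degree x) = (\<Sum>A\<in>\<A>. card (X \<inter> A))"
proof -
  have "(\<Sum>x\<in>X. degree x) = (\<Sum>x\<in>X. \<Sum>A\<in>\<A>. of_bool (x \<in> A))"
    by (simp add: degree_def Int_def)
  also have "\<dots> = (\<Sum>A\<in>\<A>. \<Sum>x\<in>X. of_bool (x \<in> A))"
    by (rule sum.swap)
  finally show ?thesis
    by (simp add: Int_def)
qed

text \<open>Double counting: \<open>A\<close> meets itself in \<open>2 * k\<close> points and each
  other member in \<open>k\<close>.\<close>

lemma sum_degree_member:
  assumes "A \<in> \<A>"
  shows "(\<Sum>x\<in>A. degree x) = k * (card \<A> + 1)"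
proof -
  have "(\<Sum>x\<in>A. degree x) = card (A \<inter> A) + (\<Sum>B\<in>\<A> - {A}. card (A \<inter> B))"
    using assms by (simp add: sum_degree sum.remove)
  also have "\<dots> = 2 * k + (\<Sum>B\<in>\<A> - {A}. k)"
    using card_member[OF assms] card_Int[OF assms]
    by (intro arg_cong2[where f = "(+)"] sum.cong) auto
  also have "\<dots> = k * (card \<A> + 1)"
    using assms card_gt_0_iff[of \<A>]
    by (auto simp: card_Diff_singleton algebra_simps)
  finally show ?thesis .
qed

text \<open>
  Together with the empty set, the family is an equidistant binary code with \<open>M = card \<A> + 1\<close> words.
  The bound compares the \<open>x\<close>-th coordinate of the difference between the barycentres of the words
  containing \<open>x\<close> and of the words avoiding \<open>x\<close> with the norm of that difference.
\<close>

lemma degree_quadratic: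
  "degree x * (card \<A> + 1 - degree x) \<le> k * (card \<A> + 1)"
proof (cases "degree x = 0")
  case False
  define d e where "d = real (degree x)" and "e = real (card \<A> + 1 - degree x)"
  have d_pos: "d > 0" and e_pos: "e > 0"
    using False degree_le_card[of x] by (auto simp: d_def e_def)
  \<comment> \<open>These weights are \<open>d * e\<close> times those of the barycentre difference:
    \<open>1 / d\<close> on the \<open>d\<close> words containing \<open>x\<close> and
    \<open>-1 / e\<close> on the \<open>e\<close> words avoiding it. The empty word contributes the
    zero vector.\<close>
  define c where "c A = (if x \<in> A then e else - d)" for A :: "'n set"
  define w where "w = (\<Sum>A\<in>\<A>. c A *\<^sub>R indicator_vec A)"
  \<comment> \<open>One less than \<open>e\<close>, because \<open>e\<close> also counts the empty
    word.\<close>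
  have card_out: "real (card {A \<in> \<A>. x \<notin> A}) = e - 1"
  proof -
    have "card \<A> = card {A \<in> \<A>. x \<in> A} + card {A \<in> \<A>. x \<notin> A}"
      by (subst card_Un_disjoint[symmetric]) (auto intro: arg_cong[where f = card])
    then show ?thesis
      by (simp add: e_def degree_def)
  qed
  have split: "(\<Sum>A\<in>\<A>. if x \<in> A then a else b) = d * a + (e - 1) * b" for a b :: real
    using card_out by (simp add: sum.If_cases d_def degree_def Int_def)
  have "w $ x = (\<Sum>A\<in>\<A>. if x \<in> A then e else 0)"
    unfolding w_def sum_component
    by (intro sum.cong) (auto simp: c_def indicator_vec_def)
  then have wx: "w $ x = d * e"
    by (simp add: split)
  have "(\<Sum>A\<in>\<A>. (c A)\<^sup>2) = (\<Sum>A\<in>\<A>. if x \<in> A then e\<^sup>2 else d\<^sup>2)"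
    by (intro sum.cong) (auto simp: c_def)
  then have "(\<Sum>A\<in>\<A>. (c A)\<^sup>2) = d * e\<^sup>2 + (e - 1) * d\<^sup>2"
    by (simp add: split)
  moreover have "(\<Sum>A\<in>\<A>. c A) = d"
    by (simp add: split c_def algebra_simps)
  ultimately have "w \<bullet> w = real k * (d\<^sup>2 + (d * e\<^sup>2 + (e - 1) * d\<^sup>2))"
    using inner_self_combination[of c] by (simp add: w_def)
  also have "\<dots> = (d * e) * (real k * (d + e))"
    by (simp add: power2_eq_square algebra_simps)
  finally have ww: "w \<bullet> w = (d * e) * (real k * (d + e))" .
  have "(w $ x)\<^sup>2 \<le> (norm w)\<^sup>2"
    using component_le_norm_cart[of w x] by (simp add: abs_le_square_iff[symmetric])
  then have "(d * e)\<^sup>2 \<le> (d * e) * (real k * (d + e))"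
    by (simp only: power2_norm_eq_inner ww wx)
  then have "(d * e) * (d * e) \<le> (d * e) * (real k * (d + e))"
    by (simp only: power2_eq_square)
  then have "d * e \<le> real k * (d + e)"
    using d_pos e_pos by (simp only: mult_le_cancel_left_pos[OF mult_pos_pos])
  moreover have "d + e = real (card \<A> + 1)"
    using degree_le_card[of x] by (simp add: d_def e_def)
  ultimately have "real (degree x * (card \<A> + 1 - degree x)) \<le> real (k * (card \<A> + 1))"
    by (simp only: d_def e_def of_nat_mult)
  then show ?thesis
    by (simp only: of_nat_le_iff)
qed simp

text \<open>With m = \<open>card \<A>\<close>, the quadratic d(m + 1 - d) is concave in d and takes
  the value (k + 1)(m - k) at both ends of the range from k + 1 to m - k. This exceeds k(m + 1) as
  soon as m is at least (k + 1)^2, against \<open>degree_quadratic\<close>.\<close>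

lemma degree_dichotomy:
  assumes "(k + 1)\<^sup>2 \<le> card \<A>"
  shows "degree x \<le> k \<or> card \<A> + 1 \<le> degree x + k"
proof (rule ccontr)
  assume "\<not> ?thesis"
  then have between: "int k + 1 \<le> int (degree x)" "int (degree x) \<le> int (card \<A>) - int k"
    by auto
  have "int (degree x * (card \<A> + 1 - degree x)) \<le> int (k * (card \<A> + 1))"
    using degree_quadratic[of x] by (simp only: of_nat_le_iff)
  moreover have "int (card \<A> + 1 - degree x) = int (card \<A>) + 1 - int (degree x)"
    using degree_le_card[of x] by simp
  ultimately have quad: "int (degree x) * (int (card \<A>) + 1 - int (degree x)) \<le> int k * (int (card \<A>) + 1)"
    by (simp only: of_nat_mult of_nat_add of_nat_1)
  \<comment> \<open>Concavity in product form: expanded, this bounds d(m + 1 - d) from below by (k +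
    1)(m - k).\<close>
  have "0 \<le> (int (degree x) - (int k + 1)) * (int (card \<A>) - int k - int (degree x))"
    using between by simp
  moreover have "(int k + 1)\<^sup>2 \<le> int (card \<A>)"
    using assms by (metis of_nat_1 of_nat_add of_nat_le_iff of_nat_power)
  ultimately show False
    using quad by (simp add: algebra_simps power2_eq_square)
qed

section \<open>The kernel of a large family\<close>

definition core :: "'n set" where
  "core = {x. degree x > k}"

text \<open>The degrees over \<open>A\<close> add up to k(m + 1). Core points have degree between m
  + 1 - k and m, the other points of \<open>A\<close> between 1 and k. Estimating the sum both ways
  leaves k as the only possible number of core points.\<close>

lemma card_Int_core:
  assumes large: "(k + 1)\<^sup>2 \<le> card \<A>" and A: "A \<in> \<A>"
  shows "card (A \<inter> core) = k"
proof -
  define a where "a = int (card (A \<inter> core))"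
  define m where "m = int (card \<A>)"
  have "card A = card (A \<inter> core) + card (A - core)"
    by (subst card_Un_disjoint[symmetric]) (auto intro: arg_cong[where f = card])
  then have rest: "int (card (A - core)) = 2 * int k - a"
    using card_member[OF A] by (simp add: a_def)
  have "(\<Sum>x\<in>A. int (degree x)) = (\<Sum>x\<in>A \<inter> core. int (degree x)) + (\<Sum>x\<in>A - core. int (degree x))"
    by (subst sum.union_disjoint[symmetric]) (auto intro: sum.cong)
  moreover have "(\<Sum>x\<in>A. int (degree x)) = int k * (m + 1)"
    unfolding of_nat_sum[symmetric] sum_degree_member[OF A] by (simp add: m_def algebra_simps)
  ultimately have total:
    "(\<Sum>x\<in>A \<inter> core. int (degree x)) + (\<Sum>x\<in>A - core. int (degree x)) = int k * (m + 1)"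
    by simp
  have high: "m + 1 - int k \<le> int (degree x)" if "x \<in> A \<inter> core" for x
    using degree_dichotomy[OF large, of x] that by (auto simp: core_def m_def)
  \<comment> \<open>\<open>A\<close> itself is a member through \<open>x\<close>.\<close>
  have pos: "1 \<le> int (degree x)" if "x \<in> A - core" for x
    using that A card_gt_0_iff[of "{B \<in> \<A>. x \<in> B}"] by (auto simp: degree_def)
  have "a * (m + 1 - int k) + (2 * int k - a) * 1
      \<le> (\<Sum>x\<in>A \<inter> core. int (degree x)) + (\<Sum>x\<in>A - core. int (degree x))"
    unfolding rest[symmetric] unfolding a_def
    by (intro add_mono sum_bounded_below high pos)
  then have lower: "a * (m - int k) \<le> int k * (m - 1)"
    unfolding total by (simp add: algebra_simps)
  have "(\<Sum>x\<in>A \<inter> core. int (degree x)) + (\<Sum>x\<in>A - core. int (degree x))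
      \<le> a * m + (2 * int k - a) * int k"
    unfolding rest[symmetric] unfolding a_def
    by (intro add_mono sum_bounded_above) (auto simp: core_def m_def degree_le_card)
  then have upper: "int k * (m + 1 - 2 * int k) \<le> a * (m - int k)"
    unfolding total by (simp add: algebra_simps)
  have m: "(int k + 1)\<^sup>2 \<le> m"
    using large unfolding m_def by (metis of_nat_1 of_nat_add of_nat_le_iff of_nat_power)
  then have mk: "int k * int k + 2 * int k + 1 \<le> m"
    by (simp add: power2_eq_square algebra_simps)
  have sq: "0 \<le> int k * int k"
    by simp
  have "m - int k \<ge> 0"
    using mk sq by linarith
  \<comment> \<open>Here \<open>a\<close> at least k + 1, and below \<open>a\<close> at most k - 1,
    would each give m at most k^2.\<close>
  have "a \<le> int k"
  proof (rule ccontr)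
    assume "\<not> a \<le> int k"
    then have "(int k + 1) * (m - int k) \<le> a * (m - int k)"
      using \<open>m - int k \<ge> 0\<close> by (intro mult_right_mono) auto
    with lower mk show False
      by (simp add: algebra_simps)
  qed
  moreover have "int k \<le> a"
  proof (rule ccontr)
    assume "\<not> int k \<le> a"
    then have "a * (m - int k) \<le> (int k - 1) * (m - int k)"
      using \<open>m - int k \<ge> 0\<close> by (intro mult_right_mono) auto
    with upper mk show False
      by (simp add: algebra_simps)
  qed
  ultimately show ?thesis
    by (simp add: a_def)
qed

text \<open>Count incidences between core points and members. Each member accounts for exactly k of
  them, but k + 1 core points of degree at least m + 1 - k would need more than k m.\<close>

lemma card_core_le:
  assumes large: "(k + 1)\<^sup>2 \<le> card \<A>"
  shows "card core \<le> k"
proof (rule ccontr)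
  assume "\<not> card core \<le> k"
  define m where "m = int (card \<A>)"
  have mk: "int k * int k + 2 * int k + 1 \<le> m"
    using large of_nat_mono[OF large, where 'a = int]
    by (simp add: m_def power2_eq_square algebra_simps)
  have "0 \<le> int k * int k"
    by simp
  then have "(int k + 1) * (m + 1 - int k) \<le> int (card core) * (m + 1 - int k)"
    using \<open>\<not> card core \<le> k\<close> mk by (intro mult_right_mono) linarith+
  also have "\<dots> \<le> (\<Sum>x\<in>core. int (degree x))"
  proof (rule sum_bounded_below)
    show "m + 1 - int k \<le> int (degree x)" if "x \<in> core" for x
      using degree_dichotomy[OF large, of x] that by (auto simp: core_def m_def)
  qed
  also have "\<dots> = int (\<Sum>A\<in>\<A>. card (core \<inter> A))"
    unfolding of_nat_sum[symmetric] sum_degree ..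
  also have "\<dots> = m * int k"
    using card_Int_core[OF large] by (simp add: m_def Int_commute)
  finally show False
    using mk by (simp add: algebra_simps)
qed

text \<open>The core has at most k points and meets each member in k, so it lies inside every
  member. Two members share only k points, which are therefore the core.\<close>

lemma
  assumes large: "(k + 1)\<^sup>2 \<le> card \<A>"
  shows core_subset: "A \<in> \<A> \<Longrightarrow> core \<subseteq> A"
    and card_core: "card core = k"
    and Int_eq_core: "A \<in> \<A> \<Longrightarrow> B \<in> \<A> \<Longrightarrow> A \<noteq> B \<Longrightarrow> A \<inter> B = core"
proof -
  have *: "A \<inter> core = core" if "A \<in> \<A>" for A
    using card_Int_core[OF large that] card_core_le[OF large]
    by (intro card_seteq) auto
  then show sub: "core \<subseteq> A" if "A \<in> \<A>" for A
    using that by blast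
  obtain C where "C \<in> \<A>"
    using large by fastforce
  then show card: "card core = k"
    using * card_Int_core[OF large] by metis
  show "A \<inter> B = core" if "A \<in> \<A>" "B \<in> \<A>" "A \<noteq> B"
    using sub[OF that(1)] sub[OF that(2)] card card_Int[OF that]
    by (intro card_seteq[symmetric]) auto
qed

text \<open>The core and the petals \<open>A - core\<close> are \<open>card \<A> + 1\<close>
  pairwise disjoint \<open>k\<close>-sets.\<close>

lemma card_le_petals:
  assumes large: "(k + 1)\<^sup>2 \<le> card \<A>"
  shows "k * (card \<A> + 1) \<le> CARD('n)"
proof -
  have petal: "card (A - core) = k" if "A \<in> \<A>" for A
    using card_Diff_subset[OF _ core_subset[OF large that]] card_member[OF that] card_core[OF large]
    by simp
  have "k * (card \<A> + 1) = card core + (\<Sum>A\<in>\<A>. card (A - core))"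
    using petal card_core[OF large] by simp
  also have "(\<Sum>A\<in>\<A>. card (A - core)) = card (\<Union>A\<in>\<A>. A - core)"
    using Int_eq_core[OF large] by (intro card_UN_disjoint[symmetric]) auto
  also have "card core + card (\<Union>A\<in>\<A>. A - core) = card (core \<union> (\<Union>A\<in>\<A>. A - core))"
    by (intro card_Un_disjoint[symmetric]) auto
  also have "\<dots> \<le> CARD('n)"
    by (intro card_mono) auto
  finally show ?thesis .
qed

end

section \<open>Sums of strongly orthogonal roots\<close>

lemma roots_A_cases:
  assumes "\<gamma> \<in> roots_A"
  obtains i j where "\<gamma> = axis i 1 - axis j 1" "i \<noteq> j" "support \<gamma> = {i, j}"
  using assms by (fastforce simp: roots_A_def support_def axis_def split: if_splits)

lemma SOS_rootD:
  assumes "\<Gamma> \<in> SOS k roots_A" "\<gamma> \<in> \<Gamma>"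
  shows "\<gamma> \<in> roots_A"
  using assms by (auto simp: SOS_def)

lemma SOS_disjoint:
  assumes "\<Gamma> \<in> SOS k roots_A" "\<gamma> \<in> \<Gamma>" "\<delta> \<in> \<Gamma>" "\<gamma> \<noteq> \<delta>"
  shows "support \<gamma> \<inter> support \<delta> = {}"
  using assms strongly_orthogonal_roots_A_iff[of \<gamma> \<delta>]
  unfolding SOS_def support_def by (auto simp: pairwise_def)

text \<open>Disjoint supports leave a single nonzero summand at each such coordinate, so nothing
  cancels.\<close>

lemma Sum_SOS_component:
  assumes "\<Gamma> \<in> SOS k roots_A" "\<gamma> \<in> \<Gamma>" "i \<in> support \<gamma>"
  shows "(\<Sum>\<Gamma>) $ i = \<gamma> $ i"
proof -
  have "\<delta> $ i = 0" if "\<delta> \<in> \<Gamma> - {\<gamma>}" for \<delta>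
    using SOS_disjoint[OF assms(1,2), of \<delta>] that assms(3) by (auto simp: support_def)
  moreover have "finite \<Gamma>"
    using assms(1) by (simp add: SOS_def)
  ultimately show ?thesis
    using assms(2) by (simp add: sum_component sum.remove)
qed

lemma support_Sum_SOS:
  assumes "\<Gamma> \<in> SOS k roots_A"
  shows "support (\<Sum>\<Gamma>) = (\<Union>\<gamma>\<in>\<Gamma>. support \<gamma>)"
proof (intro equalityI subsetI)
  fix i assume "i \<in> support (\<Sum>\<Gamma>)"
  then show "i \<in> (\<Union>\<gamma>\<in>\<Gamma>. support \<gamma>)"
    using sum.not_neutral_contains_not_neutral[of "\<lambda>\<gamma>. \<gamma> $ i" \<Gamma>]
    by (auto simp: support_def sum_component)
next
  fix i assume "i \<in> (\<Union>\<gamma>\<in>\<Gamma>. support \<gamma>)"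
  then show "i \<in> support (\<Sum>\<Gamma>)"
    using Sum_SOS_component[OF assms] by (auto simp: support_def)
qed

lemma Sum_SOS_entries:
  assumes "\<Gamma> \<in> SOS k roots_A"
  shows "(\<Sum>\<Gamma>) $ i \<in> {-1, 0, 1}"
proof (cases "i \<in> support (\<Sum>\<Gamma>)")
  case True
  then obtain \<gamma> where \<gamma>: "\<gamma> \<in> \<Gamma>" "i \<in> support \<gamma>"
    using support_Sum_SOS[OF assms] by auto
  from SOS_rootD[OF assms \<gamma>(1)] show ?thesis
    unfolding Sum_SOS_component[OF assms \<gamma>] by (auto simp: roots_A_def axis_def)
qed (simp add: support_def)

lemma card_support_Sum_SOS:
  assumes "\<Gamma> \<in> SOS k roots_A"
  shows "card (support (\<Sum>\<Gamma>)) = 2 * k"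
proof -
  have fin: "finite \<Gamma>" and card: "card \<Gamma> = k"
    using assms by (auto simp: SOS_def)
  have "card (support (\<Sum>\<Gamma>)) = (\<Sum>\<gamma>\<in>\<Gamma>. card (support \<gamma>))"
    unfolding support_Sum_SOS[OF assms]
    using fin SOS_disjoint[OF assms] by (intro card_UN_disjoint) auto
  also have "\<dots> = (\<Sum>\<gamma>\<in>\<Gamma>. 2)"
  proof (intro sum.cong refl)
    fix \<gamma> assume "\<gamma> \<in> \<Gamma>"
    then obtain i j where "i \<noteq> j" "support \<gamma> = {i, j}"
      using SOS_rootD[OF assms] roots_A_cases by metis
    then show "card (support \<gamma>) = 2"
      by simp
  qed
  finally show ?thesis
    using card by simp
qed

section \<open>From cliques to their supports\<close>

lemma card_Int_support_clique:
  fixes \<Gamma> :: "(real ^ 'n) set"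
  assumes clique: "SOS_clique k roots_A \<F>" and "\<Gamma> \<in> \<F>" "\<Delta> \<in> \<F>" "\<Gamma> \<noteq> \<Delta>"
  shows "card (support (\<Sum>\<Gamma>) \<inter> support (\<Sum>\<Delta>)) = k"
proof -
  let ?A = "support (\<Sum>\<Gamma>)" and ?B = "support (\<Sum>\<Delta>)"
  have \<Gamma>: "\<Gamma> \<in> SOS k roots_A" and \<Delta>: "\<Delta> \<in> SOS k roots_A"
    using assms by (auto simp: SOS_clique_def)
  obtain \<Theta> where \<Theta>: "\<Theta> \<in> SOS k roots_A" "\<Sum>\<Gamma> - \<Sum>\<Delta> = \<Sum>\<Theta>"
    using assms unfolding SOS_clique_def by blast
  \<comment> \<open>Where both sums are nonzero, their difference is 0, 2 or -2, and only 0 is an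
    entry of \<open>\<Sum>\<Theta>\<close>.\<close>
  have "i \<in> support (\<Sum>\<Theta>) \<longleftrightarrow> i \<in> (?A - ?B) \<union> (?B - ?A)" for i
    using Sum_SOS_entries[OF \<Gamma>, of i] Sum_SOS_entries[OF \<Delta>, of i] Sum_SOS_entries[OF \<Theta>(1), of i]
    unfolding \<Theta>(2)[symmetric] by (auto simp: support_def)
  then have "support (\<Sum>\<Theta>) = (?A - ?B) \<union> (?B - ?A)"
    by blast
  then have "2 * k = card ((?A - ?B) \<union> (?B - ?A))"
    using card_support_Sum_SOS[OF \<Theta>(1)] by simp
  also have "\<dots> = card (?A - ?B) + card (?B - ?A)"
    by (rule card_Un_disjoint) auto
  finally have "2 * k = card (?A - ?B) + card (?B - ?A)" .
  \<comment> \<open>Both supports have \<open>2 * k\<close> elements, so the symmetric difference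
    has 4k minus twice the size of the intersection.\<close>
  moreover have "card ?A = card (?A \<inter> ?B) + card (?A - ?B)" "card ?B = card (?A \<inter> ?B) + card (?B - ?A)"
    by (subst card_Un_disjoint[symmetric]; auto intro: arg_cong[where f = card])+
  ultimately show ?thesis
    using card_support_Sum_SOS[OF \<Gamma>] card_support_Sum_SOS[OF \<Delta>] by simp
qed

text \<open>Injectivity lets cardinalities pass between a clique and its supports: two members with
  equal supports would meet in \<open>2 * k\<close> points instead of \<open>k\<close>, and
  \<open>k\<close> is positive.\<close>

lemma clique_supports:
  fixes \<F> :: "(real ^ 'n) set set"
  assumes k: "k > 0" and clique: "SOS_clique k roots_A \<F>"
  defines "\<A> \<equiv> (\<lambda>\<Gamma>. support (\<Sum>\<Gamma>)) ` \<F>"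
  shows "half_intersecting k \<A>" and "inj_on (\<lambda>\<Gamma>. support (\<Sum>\<Gamma>)) \<F>"
proof -
  have SOS: "\<Gamma> \<in> SOS k roots_A" if "\<Gamma> \<in> \<F>" for \<Gamma>
    using clique that by (auto simp: SOS_clique_def)
  show "half_intersecting k \<A>"
  proof
    show "card A = 2 * k" if "A \<in> \<A>" for A
      using that SOS card_support_Sum_SOS by (auto simp: \<A>_def)
    show "card (A \<inter> B) = k" if "A \<in> \<A>" "B \<in> \<A>" "A \<noteq> B" for A B
      using that card_Int_support_clique[OF clique] by (auto simp: \<A>_def)
  qed (fact k)
  show "inj_on (\<lambda>\<Gamma>. support (\<Sum>\<Gamma>)) \<F>"
  proof (rule inj_onI, rule ccontr)
    fix \<Gamma> \<Delta> assume *: "\<Gamma> \<in> \<F>" "\<Delta> \<in> \<F>" "support (\<Sum>\<Gamma>) = support (\<Sum>\<Delta>)" "\<Gamma> \<noteq> \<Delta>"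
    then show False
      using card_Int_support_clique[OF clique *(1,2,4)] card_support_Sum_SOS[OF SOS[OF *(1)]] k
      by simp
  qed
qed

lemma clique_card_le:
  fixes \<F> :: "(real ^ 'n) set set"
  assumes "k > 0" "SOS_clique k roots_A \<F>"
  shows "card \<F> \<le> CARD('n)"
  using half_intersecting.card_le_CARD[OF clique_supports(1)[OF assms]]
  by (simp add: card_image[OF clique_supports(2)[OF assms]])

lemma large_clique:
  fixes \<F> :: "(real ^ 'n) set set"
  assumes "k > 0" "SOS_clique k roots_A \<F>" and large: "(k + 1)\<^sup>2 \<le> card \<F>"
  shows "is_sunflower \<F>" and "k * (card \<F> + 1) \<le> CARD('n)"
proof -
  define \<A> where "\<A> = (\<lambda>\<Gamma>. support (\<Sum>\<Gamma>)) ` \<F>"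
  interpret half_intersecting k \<A>
    unfolding \<A>_def using assms(1,2) by (rule clique_supports)
  have inj: "inj_on (\<lambda>\<Gamma>. support (\<Sum>\<Gamma>)) \<F>"
    using assms(1,2) by (rule clique_supports)
  have card: "card \<A> = card \<F>"
    by (simp add: \<A>_def card_image[OF inj])
  show "k * (card \<F> + 1) \<le> CARD('n)"
    using card_le_petals large by (simp add: card)
  have "common_support \<Gamma> \<Delta> = core" if "\<Gamma> \<in> \<F>" "\<Delta> \<in> \<F>" "\<Gamma> \<noteq> \<Delta>" for \<Gamma> \<Delta>
  proof -
    have "common_support \<Gamma> \<Delta> = support (\<Sum>\<Gamma>) \<inter> support (\<Sum>\<Delta>)"
      by (auto simp: common_support_def support_def)
    moreover have "support (\<Sum>\<Gamma>) \<noteq> support (\<Sum>\<Delta>)"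
      using inj that by (auto simp: inj_on_def)
    ultimately show ?thesis
      using Int_eq_core[of "support (\<Sum>\<Gamma>)" "support (\<Sum>\<Delta>)"] large that
      unfolding card by (simp add: \<A>_def)
  qed
  then show "is_sunflower \<F>"
    unfolding is_sunflower_def by simp
qed

section \<open>Construction of a large clique\<close>

lemma SOS_with_Sum:
  fixes S P :: "'n::finite set"
  assumes "card S = k" "card P = k" and disj: "S \<inter> P = {}"
  obtains \<Gamma> where "\<Gamma> \<in> SOS k roots_A" "\<Sum>\<Gamma> = indicator_vec S - indicator_vec P"
proof -
  \<comment> \<open>Pairing \<open>S\<close> with \<open>P\<close> turns the difference of
    indicators into a sum of roots with disjoint supports.\<close>
  obtain f where f: "bij_betw f S P"
    using finite_same_card_bij[of S P] assms by auto
  define g where "g s = (axis s 1 - axis (f s) 1 :: real ^ 'n)" for s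
  have fP: "f s \<in> P" and fS: "f s \<notin> S" if "s \<in> S" for s
    using bij_betwE[OF f] that disj by auto
  have supp: "{i. g s $ i \<noteq> 0} = {s, f s}" if "s \<in> S" for s
    using fS[OF that] that by (auto simp: g_def axis_def split: if_splits)
  \<comment> \<open>The root \<open>g s\<close> determines \<open>s\<close> as the only point of
    \<open>S\<close> in its support.\<close>
  have inj: "inj_on g S"
    using supp fS by (intro inj_onI) (metis insert_iff singletonD)
  have root: "g s \<in> roots_A" if "s \<in> S" for s
    using fS[OF that] that unfolding g_def roots_A_def by (intro CollectI exI[of _ s] exI[of _ "f s"]) auto
  have orth: "strongly_orthogonal roots_A (g s) (g t)" if "s \<in> S" "t \<in> S" "s \<noteq> t" for s t
  proof -
    have "f s \<noteq> f t"
      using f that by (auto simp: bij_betw_def inj_on_def)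
    then show ?thesis
      unfolding strongly_orthogonal_roots_A_iff[OF root[OF that(1)] root[OF that(2)]]
        supp[OF that(1)] supp[OF that(2)]
      using that fS by auto
  qed
  have "g ` S \<in> SOS k roots_A"
    using root orth card_image[OF inj] assms(1) by (auto simp: SOS_def pairwise_def)
  moreover have sum_axis: "(\<Sum>s\<in>X. axis s 1) = indicator_vec X" for X :: "'n set"
    by (simp add: vec_eq_iff indicator_vec_def axis_def sum_component)
  have "(\<Sum>s\<in>S. axis (f s) 1 :: real ^ 'n) = (\<Sum>s\<in>P. axis s 1)"
    using sum.reindex_bij_betw[OF f] .
  then have "\<Sum>(g ` S) = indicator_vec S - indicator_vec P"
    unfolding sum.reindex[OF inj] by (simp add: g_def sum_subtractf sum_axis)
  ultimately show thesis ..
qed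

text \<open>The block \<open>P 0\<close> is the kernel and \<open>P 1\<close> to \<open>P m\<close>
  are the petals. In the difference of two members the kernel cancels, leaving a difference of
  indicators of disjoint blocks, again covered by \<open>SOS_with_Sum\<close>.\<close>

lemma clique_exists:
  assumes k: "k > 0" and room: "k * (m + 1) \<le> CARD('n::finite)"
  obtains \<F> :: "(real ^ 'n) set set" where "SOS_clique k roots_A \<F>" "card \<F> = m"
proof -
  obtain h :: "nat \<Rightarrow> 'n" where h: "bij_betw h {..<CARD('n)} UNIV"
    using ex_bij_betw_nat_finite[of "UNIV :: 'n set"] by (auto simp: atLeast0LessThan)
  define P where "P j = h ` {k * j..<k * j + k}" for j
  have block: "{k * j..<k * j + k} \<subseteq> {..<CARD('n)}" if "j \<le> m" for j
  proof -
    have "k * (j + 1) \<le> k * (m + 1)"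
      using that by (intro mult_left_mono) auto
    then have "k * j + k \<le> CARD('n)"
      using room by (simp only: distrib_left mult_1_right)
    then show ?thesis
      by auto
  qed
  have card_P: "card (P j) = k" if "j \<le> m" for j
    unfolding P_def using card_image[OF inj_on_subset[OF bij_betw_imp_inj_on[OF h] block[OF that]]]
    by simp
  have disj_P: "P i \<inter> P j = {}" if "i \<le> m" "j \<le> m" "i \<noteq> j" for i j
  proof -
    have "{k * i..<k * i + k} \<inter> {k * j..<k * j + k} = {}" if "i < j" for i j
    proof -
      have "k * (i + 1) \<le> k * j"
        using that by (intro mult_left_mono) auto
      then show ?thesis
        by auto
    qed
    then have blocks: "{k * i..<k * i + k} \<inter> {k * j..<k * j + k} = {}"
      using \<open>i \<noteq> j\<close> by (metis Int_commute linorder_neqE_nat)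
    then show ?thesis
      unfolding P_def
        inj_on_image_Int[OF bij_betw_imp_inj_on[OF h] block[OF that(1)] block[OF that(2)], symmetric]
      by (simp only: blocks image_empty)
  qed
  have "\<forall>j\<in>{1..m}. \<exists>\<Gamma>. \<Gamma> \<in> SOS k roots_A \<and> \<Sum>\<Gamma> = indicator_vec (P 0) - indicator_vec (P j)"
    using SOS_with_Sum[OF card_P card_P disj_P] by (metis atLeastAtMost_iff le0 not_one_le_zero)
  then obtain G where G: "G j \<in> SOS k roots_A" "\<Sum>(G j) = indicator_vec (P 0) - indicator_vec (P j)"
    if "j \<in> {1..m}" for j
    by metis
  have inj: "inj_on G {1..m}"
  proof (rule inj_onI, rule ccontr)
    fix i j assume *: "i \<in> {1..m}" "j \<in> {1..m}" "G i = G j" "i \<noteq> j"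
    then have "indicator_vec (P i) = indicator_vec (P j)"
      using G(2)[of i] G(2)[of j] by simp
    then have "P i = P j"
      by (rule injD[OF inj_indicator_vec])
    \<comment> \<open>A block equal to another is disjoint from itself, hence empty, although it has
      \<open>k > 0\<close> elements.\<close>
    with disj_P[of i j] card_P[of i] * k show False
      by auto
  qed
  have "SOS_clique k roots_A (G ` {1..m})"
    unfolding SOS_clique_def
  proof (intro conjI ballI impI)
    show "G ` {1..m} \<subseteq> SOS k roots_A"
      using G(1) by auto
    fix \<Gamma> \<Delta> assume "\<Gamma> \<in> G ` {1..m}" "\<Delta> \<in> G ` {1..m}" "\<Gamma> \<noteq> \<Delta>"
    then obtain i j where ij: "i \<in> {1..m}" "j \<in> {1..m}" "i \<noteq> j" "\<Gamma> = G i" "\<Delta> = G j"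
      by blast
    then obtain \<Theta> where "\<Theta> \<in> SOS k roots_A" "\<Sum>\<Theta> = indicator_vec (P j) - indicator_vec (P i)"
      using SOS_with_Sum[OF card_P card_P disj_P, of j i] by auto
    then show "\<exists>\<Theta>\<in>SOS k roots_A. \<Sum>\<Gamma> - \<Sum>\<Delta> = \<Sum>\<Theta>"
      using G(2)[OF ij(1)] G(2)[OF ij(2)] by (intro bexI[of _ \<Theta>]) (simp_all add: ij)
  qed
  moreover have "card (G ` {1..m}) = m"
    unfolding card_image[OF inj] by simp
  ultimately show thesis ..
qed

section \<open>The maximum clique size\<close>

lemma clique_card_le_max:
  assumes "SOS_clique k (roots_A :: (real ^ 'n) set) \<F>"
  shows "card \<F> \<le> max_SOS_clique k (roots_A :: (real ^ 'n) set)"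
  unfolding max_SOS_clique_def
  using finite_SOS_clique_cards(1)[OF finite_roots_A] assms by (intro Max_ge) auto

lemma max_clique_exists:
  obtains \<F> where "SOS_clique k (roots_A :: (real ^ 'n) set) \<F>"
    "card \<F> = max_SOS_clique k (roots_A :: (real ^ 'n) set)"
proof -
  have "max_SOS_clique k (roots_A :: (real ^ 'n) set) \<in> {card \<F> | \<F>. SOS_clique k (roots_A :: (real ^ 'n) set) \<F>}"
    unfolding max_SOS_clique_def
    using finite_SOS_clique_cards[OF finite_roots_A] by (intro Max_in) auto
  then show thesis
    using that by auto
qed

text \<open>Relates the hypothesis on \<open>l\<close> to the threshold of
  \<open>large_clique\<close>. At \<open>k = 1\<close> both sides equal 4, so the induction starts
  at 2.\<close>

lemma square_Suc_less_four_power: "(k + 1)\<^sup>2 < 4 ^ k" if "k \<ge> 2" for k :: nat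
  using that
proof (induction k rule: dec_induct)
  case (step k)
  then show ?case
    by (simp add: power2_eq_square algebra_simps)
qed (simp add: power2_eq_square)

theorem theorem3p5:
  fixes k l :: nat
  assumes "k \<ge> 1" and "l \<ge> 1" and "CARD('n::finite) = l + 1"
  shows "max_SOS_clique k (roots_A :: (real ^ 'n) set) \<le> l + 1 \<and>
    (l > k * 4 ^ k \<longrightarrow>
      int (max_SOS_clique k (roots_A :: (real ^ 'n) set)) = \<lfloor>(real l + 1 - real k) / real k\<rfloor> \<and>
      (\<forall>\<F>. SOS_clique k (roots_A :: (real ^ 'n) set) \<F> \<and>
            card \<F> = max_SOS_clique k (roots_A :: (real ^ 'n) set) \<longrightarrow>
            is_sunflower \<F>))"
proof -
  let ?\<mu> = "max_SOS_clique k (roots_A :: (real ^ 'n) set)"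
  have k: "k > 0"
    using assms(1) by simp
  obtain \<M> :: "(real ^ 'n) set set" where \<M>: "SOS_clique k roots_A \<M>" "card \<M> = ?\<mu>"
    using max_clique_exists .
  have "?\<mu> \<le> l + 1"
    using clique_card_le[OF k \<M>(1)] \<M>(2) assms(3) by simp
  moreover have "int ?\<mu> = \<lfloor>(real l + 1 - real k) / real k\<rfloor> \<and>
      (\<forall>\<F>. SOS_clique k (roots_A :: (real ^ 'n) set) \<F> \<and> card \<F> = ?\<mu> \<longrightarrow> is_sunflower \<F>)"
    if l: "l > k * 4 ^ k"
  proof -
    \<comment> \<open>The largest number of petals that fit beside a kernel:
      \<open>k * (m + 1) \<le> l + 1\<close>.\<close>
    define m where "m = (l + 1) div k - 1"
    have "(k + 1)\<^sup>2 + 1 \<le> (l + 1) div k"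
    \<comment> \<open>For \<open>k = 1\<close> the claim is that \<open>l + 1\<close> is at least 5,
      which \<open>l > 4\<close> gives directly.\<close>
    proof (cases "k = 1")
      case False
      then have "k * ((k + 1)\<^sup>2 + 1) \<le> k * 4 ^ k"
        using square_Suc_less_four_power[of k] k by (intro mult_left_mono) auto
      then show ?thesis
        using l k by (simp only: less_eq_div_iff_mult_less_eq mult.commute)
    qed (use l in \<open>simp add: power2_eq_square\<close>)
    then have m_large: "(k + 1)\<^sup>2 \<le> m" and m1: "m + 1 = (l + 1) div k"
      by (simp_all add: m_def)
    have room: "k * (m + 1) \<le> CARD('n)"
      unfolding m1 assms(3) by simp
    obtain \<F> :: "(real ^ 'n) set set" where "SOS_clique k roots_A \<F>" "card \<F> = m"
      using clique_exists[OF k room] .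
    then have "m \<le> ?\<mu>"
      using clique_card_le_max by metis
    \<comment> \<open>The constructed clique lifts the maximum over the threshold, so the sunflower
      structure applies to every maximum clique.\<close>
    then have \<mu>_large: "(k + 1)\<^sup>2 \<le> ?\<mu>"
      using m_large by simp
    then have "k * (?\<mu> + 1) \<le> l + 1"
      using large_clique(2)[OF k \<M>(1)] \<M>(2) assms(3) by simp
    then have "?\<mu> + 1 \<le> (l + 1) div k"
      using k by (simp add: less_eq_div_iff_mult_less_eq mult.commute)
    then have \<mu>: "?\<mu> + 1 = (l + 1) div k"
      using \<open>m \<le> ?\<mu>\<close> m1 by linarith
    have "(real l + 1 - real k) / real k = real (l + 1) / real k - 1"
      using k by (simp add: field_simps)
    then have "\<lfloor>(real l + 1 - real k) / real k\<rfloor> = int ((l + 1) div k) - 1"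
      by (simp only: floor_diff_one floor_divide_of_nat_eq)
    then have "int ?\<mu> = \<lfloor>(real l + 1 - real k) / real k\<rfloor>"
      using \<mu> by linarith
    moreover have "is_sunflower \<F>" if "SOS_clique k roots_A \<F>" "card \<F> = ?\<mu>" for \<F> :: "(real ^ 'n) set set"
      using large_clique(1)[OF k that(1)] that(2) \<mu>_large by simp
    ultimately show ?thesis
      by blast
  qed
  ultimately show ?thesis
    by blast
qed

end
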